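(* Let $f\in\mathscr{S}^*_e$ and let $f^{-1}(\omega)=\omega+\sum_{n=2}^{\infty}A_n\omega^n$ in some neighbourhood of the origin. Then the following sharp estimates hold: $$|A_2|\leq 1,\quad |A_3|\leq \frac{5}{4},\quad |A_4|\leq\frac{31}{18}\quad\text{and}\quad |A_5|\leq\frac{361}{144}.$$ Here sharp means that for each of these bounds there is a function $f\in\mathscr{S}^*_e$ for which equality holds.
   Context: $\mathbb{D}=\{z\in\mathbb{C}:|z|<1\}$. $\mathscr{A}$ is the class of functions $f$ analytic in $\mathbb{D}$ with $f(0)=0$, $f'(0)=1$. For analytic $F,G:\mathbb{D}\to\mathbb{C}$, $F\prec G$ (subordination) means that $F(z)=G(w(z))$ in $\mathbb{D}$ for some analytic $w:\mathbb{D}\to\mathbb{D}$ with $w(0)=0$. The class $\mathscr{S}^*_e$ is $\{f\in\mathscr{A}: zf'(z)/f(z)\prec e^z\}$, where $zf'(z)/f(z)$ is given the value $1$ at $z=0$; equivalently, $zf'(z)/f(z)$ takes values in $\{w\in\mathbb{C}:|\log w|<1\}$. $f^{-1}$ denotes the local inverse of $f$ near the origin with $f^{-1}(0)=0$. *)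

theory Defs
  imports "HOL-Complex_Analysis.Complex_Analysis"
begin

abbreviation unit_disc :: "complex set" where
  "unit_disc \<equiv> ball 0 1"

definition class_A :: "(complex \<Rightarrow> complex) set" where
  "class_A = {f. f analytic_on unit_disc \<and> f 0 = 0 \<and> deriv f 0 = 1}"

definition subordinate :: "(complex \<Rightarrow> complex) \<Rightarrow> (complex \<Rightarrow> complex) \<Rightarrow> bool"
    (infix "\<prec>" 50) where
  "F \<prec> G \<longleftrightarrow> F analytic_on unit_disc \<and> G analytic_on unit_disc \<and>
     (\<exists>w. w analytic_on unit_disc \<and> w ` unit_disc \<subseteq> unit_disc \<and> w 0 = 0 \<and>
          (\<forall>z\<in>unit_disc. F z = G (w z)))"

text \<open>The value 1 at 0 removes the singularity of the quotient. If f had a zero in the punctured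
  disc, the quotient would be 0 there (division by zero), which is not a value of the exponential;
  so membership in the class below forces f to vanish only at 0.\<close>

definition starlike_quotient :: "(complex \<Rightarrow> complex) \<Rightarrow> complex \<Rightarrow> complex" where
  "starlike_quotient f z = (if z = 0 then 1 else z * deriv f z / f z)"

definition class_S_e :: "(complex \<Rightarrow> complex) set" where
  "class_S_e = {f \<in> class_A. starlike_quotient f \<prec> exp}"

text \<open>Functions are total, and only their values on the unit disc are meaningful, hence the
  restriction on U.\<close>

definition local_inverse_at_0 :: "(complex \<Rightarrow> complex) \<Rightarrow> (complex \<Rightarrow> complex) \<Rightarrow> bool" where
  "local_inverse_at_0 f g \<longleftrightarrow> g 0 = 0 \<and>
     (\<exists>U V. open U \<and> 0 \<in> U \<and> U \<subseteq> unit_disc \<and> open V \<and> 0 \<in> V \<and> homeomorphism U V f g)"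

text \<open>A is the power series at the origin of the local inverse of f. For f in class A, the
  normalisation (coefficient 0 of order 0, coefficient 1 of order 1) is a consequence.\<close>

definition inverse_expansion :: "(complex \<Rightarrow> complex) \<Rightarrow> complex fps \<Rightarrow> bool" where
  "inverse_expansion f A \<longleftrightarrow> (\<exists>g. local_inverse_at_0 f g \<and> g has_fps_expansion A)"

end

theory Submission
  imports Defs
begin

text \<open>
  If \<open>f\<close> belongs to the class, \<open>z f' z / f z = exp (w z)\<close> for a Schwarz function
  \<open>w z = c1 z + c2 z^2 + \<dots>\<close>. In terms of the inverse \<open>g\<close> this reads \<open>u g' u exp (w (g u)) = g u\<close>
  (lemma \<open>inverse_series_equation\<close>), a recursion for the coefficients of \<open>g\<close>, which makes each
  of them a polynomial in the \<open>ci\<close>: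

  \<open>A2 = -c1\<close>, \<open>A3 = -c2/2 + 5/4 c1^2\<close>, \<open>A4 = -c3/3 + 5/3 c1 c2 - 31/18 c1^3\<close>,

  \<open>A5 = -c4/4 + 17/12 c1 c3 + c2^2/2 - 49/12 c1^2 c2 + 361/144 c1^4\<close>.

  In each case the factor of the pure power of \<open>c1\<close> is the claimed bound up to sign, so \<open>w z = z\<close> is
  extremal in all four cases. It remains to see that no other \<open>w\<close> does better. The Schur
  algorithm expresses \<open>c2, c3, c4\<close> through \<open>r = |c1|\<close> and three bounded parameters, with a common
  factor \<open>1 - r\<^sup>2\<close> (lemma \<open>Schwarz_coeffs\<close>). So if \<open>r < 1\<close>, the other terms gain a multiple of
  \<open>1 - r\<^sup>2\<close>, while the main term shrinks by the factor \<open>r ^ k\<close>, and the gain must not exceed the loss.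

  For \<open>A3\<close> and \<open>A4\<close> the triangle inequality shows this, and also for \<open>A5\<close> if \<open>r\<^sup>2 \<le> 4/5\<close>. For
  larger \<open>r\<close> the other terms in \<open>A5\<close> can be larger in modulus than that loss, but only where they point
  against the main term. Since they are then small compared with it, their real part decides
  (lemmas \<open>norm_scaled_minus_real_le\<close>, \<open>Re_lower_bound\<close> and \<open>fifth_coeff_bound\<close>).
\<close>

section \<open>Schur functions and the coefficients of Schwarz functions\<close>

text \<open>
  Working with Taylor series instead of functions makes the Schur algorithm a purely algebraic
  recursion; the function behind a series matters only when one step is shown to preserve the class.
\<close>

definition schur_series :: "complex fps \<Rightarrow> bool" where
  "schur_series A \<longleftrightarrow> (\<exists>\<phi>. \<phi> holomorphic_on unit_disc \<and>
     (\<forall>z\<in>unit_disc. cmod (\<phi> z) \<le> 1) \<and> \<phi> has_fps_expansion A)"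

text \<open>
  This is the Schwarz lemma, read as a passage from Schwarz functions to Schur functions: the bound
  on the derivative at the origin takes care of the removable singularity.
\<close>

lemma divided_Schwarz_function:
  assumes hol: "m holomorphic_on unit_disc" and m0: "m 0 = 0"
    and bd: "\<And>z. cmod z < 1 \<Longrightarrow> cmod (m z) < 1"
  obtains P where "schur_series P" "m has_fps_expansion fps_X * P"
proof -
  define p where "p = (\<lambda>z. if z = 0 then deriv m 0 else m z / z)"
  have holp: "p holomorphic_on unit_disc"
    by (rule pole_theorem_open_0[OF hol, of 0]) (auto simp: p_def m0)
  have "cmod (p z) \<le> 1" if "z \<in> unit_disc" for z
    using Schwarz_Lemma(1,2)[OF hol m0 bd, of z] that
    by (auto simp: p_def norm_divide divide_le_eq)
  moreover have P: "p has_fps_expansion fps_expansion p 0"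
    using holp by (intro has_fps_expansion_fps_expansion) auto
  ultimately have "schur_series (fps_expansion p 0)"
    using holp unfolding schur_series_def by blast
  moreover have "(\<lambda>z. z * p z) has_fps_expansion fps_X * fps_expansion p 0"
    by (intro fps_expansion_intros P)
  moreover have "(\<lambda>z. z * p z) = m"
    by (auto simp: p_def m0 fun_eq_iff)
  ultimately show thesis using that by metis
qed

text \<open>
  One step of the Schur algorithm. Moving the value at the origin to 0 by a disc automorphism
  gives a Schwarz function, and dividing it by the variable gives the next Schur function \<open>P\<close>.
  The relation below is the inversion of that automorphism with the denominator cleared; in this
  form it also covers unimodular constants, for which the automorphism degenerates.
\<close>

lemma schur_step:
  assumes "schur_series A"
  obtains P where "schur_series P"
    "A * (1 + fps_const (cnj (fps_nth A 0)) * (fps_X * P)) = fps_const (fps_nth A 0) + fps_X * P"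
proof -
  from assms obtain \<phi> where hol: "\<phi> holomorphic_on unit_disc"
    and bd: "\<And>z. z \<in> unit_disc \<Longrightarrow> cmod (\<phi> z) \<le> 1" and A: "\<phi> has_fps_expansion A"
    unfolding schur_series_def by blast
  define c where "c = fps_nth A 0"
  have c: "\<phi> 0 = c"
    unfolding c_def by (rule has_fps_expansion_imp_0_eq_fps_nth_0[OF A])
  show thesis
  proof (cases "\<exists>z\<in>unit_disc. cmod (\<phi> z) = 1")
    case True
    then obtain z where z: "z \<in> unit_disc" "cmod (\<phi> z) = 1" by blast
    have "\<phi> constant_on unit_disc"
      by (rule maximum_modulus_principle[OF hol _ _ _ _ z(1)]) (use bd z in auto)
    then have eq: "\<phi> y = c" if "y \<in> unit_disc" for y
      using c that unfolding constant_on_def by force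
    have "\<forall>\<^sub>F y in nhds 0. y \<in> unit_disc"
      by (intro eventually_nhds_in_open) auto
    then have "\<forall>\<^sub>F y in nhds 0. \<phi> y = c"
      by eventually_elim (rule eq)
    then have "(\<lambda>_. c) has_fps_expansion A"
      using A has_fps_expansion_cong by force
    then have "A = fps_const c"
      using has_fps_expansion_const fps_expansion_unique_complex by blast
    \<comment> \<open>a unimodular constant leaves no freedom; the zero series then satisfies the relation\<close>
    moreover have "schur_series 0"
      unfolding schur_series_def by (intro exI[of _ "\<lambda>_. 0"]) auto
    ultimately show thesis using that[of 0] by simp
  next
    case False
    then have lt: "cmod (\<phi> z) < 1" if "cmod z < 1" for z
      using bd[of z] that by force
    then have c1: "cmod c < 1" using c by (metis norm_zero zero_less_one)
    define m where "m = (\<lambda>z. Moebius_function 0 c (\<phi> z))"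
    have nz: "1 - cnj c * \<phi> z \<noteq> 0" if "cmod z < 1" for z
    proof
      assume "1 - cnj c * \<phi> z = 0"
      then have "cmod (cnj c * \<phi> z) = 1" by (metis eq_iff_diff_eq_0 norm_one)
      moreover have "cmod (cnj c) * cmod (\<phi> z) < 1 * 1"
        by (intro mult_strict_mono) (use c1 lt[OF that] in auto)
      ultimately show False by (simp add: norm_mult)
    qed
    have "m holomorphic_on unit_disc"
      unfolding m_def Moebius_function_def
      by (intro holomorphic_intros hol) (use nz in auto)
    moreover have "m 0 = 0" by (simp add: m_def c Moebius_function_eq_zero)
    moreover have "cmod (m z) < 1" if "cmod z < 1" for z
      unfolding m_def by (rule Moebius_function_norm_lt_1[OF c1 lt[OF that]])
    ultimately obtain P where P: "schur_series P" "m has_fps_expansion fps_X * P"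
      by (rule divided_Schwarz_function)
    have "(\<lambda>z. \<phi> z * (1 + cnj c * m z)) has_fps_expansion
        A * (1 + fps_const (cnj c) * (fps_X * P))"
      by (intro fps_expansion_intros A P(2))
    moreover have "(\<lambda>z. c + m z) has_fps_expansion fps_const c + fps_X * P"
      by (intro fps_expansion_intros P(2))
    moreover have "\<forall>\<^sub>F z in nhds 0. z \<in> unit_disc"
      by (intro eventually_nhds_in_open) auto
    then have "\<forall>\<^sub>F z in nhds 0. \<phi> z * (1 + cnj c * m z) = c + m z"
    proof eventually_elim
      case (elim z)
      then have "1 - cnj c * \<phi> z \<noteq> 0" using nz by simp
      then show ?case
        by (simp add: m_def Moebius_function_def field_simps)
    qed
    ultimately have "A * (1 + fps_const (cnj c) * (fps_X * P)) = fps_const c + fps_X * P"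
      using fps_expansion_unique_complex has_fps_expansion_cong by metis
    then show thesis using that P(1) unfolding c_def by blast
  qed
qed

lemma schur_series_nth_0_le:
  assumes "schur_series A"
  shows "cmod (fps_nth A 0) \<le> 1"
proof -
  from assms obtain \<phi> where "\<forall>z\<in>unit_disc. cmod (\<phi> z) \<le> 1" "\<phi> has_fps_expansion A"
    unfolding schur_series_def by blast
  then show ?thesis
    using has_fps_expansion_imp_0_eq_fps_nth_0 by (metis centre_in_ball zero_less_one)
qed

text \<open>
  The factor \<open>1 - (cmod a)\<^sup>2\<close> common to these coefficients is what later balances the loss in
  the powers of \<open>a\<close>.
\<close>

lemma schur_coeffs:
  fixes A :: "complex fps"
  assumes "schur_series A"
  defines "a \<equiv> fps_nth A 0"
  obtains P where "schur_series P"
    "fps_nth A 1 = (1 - (cmod a)\<^sup>2) * fps_nth P 0"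
    "fps_nth A 2 = (1 - (cmod a)\<^sup>2) * (fps_nth P 1 - cnj a * (fps_nth P 0)\<^sup>2)"
    "fps_nth A 3 = (1 - (cmod a)\<^sup>2) *
       (fps_nth P 2 - 2 * cnj a * fps_nth P 0 * fps_nth P 1 + (cnj a)\<^sup>2 * fps_nth P 0 ^ 3)"
proof -
  obtain P where P: "schur_series P" and
    eq: "A * (1 + fps_const (cnj a) * (fps_X * P)) = fps_const a + fps_X * P"
    using schur_step[OF assms(1)] unfolding a_def by blast
  \<comment> \<open>solved for the series on the left, the relation is a recursion for its coefficients\<close>
  have "A = fps_const a + fps_X * (P - fps_const (cnj a) * (A * P))"
    using eq by (simp add: algebra_simps)
  then have *: "fps_nth A (Suc n) = fps_nth P n - cnj a * fps_nth (A * P) n" for n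
    by (metis (no_types) add.left_neutral diff_Suc_1 fps_X_mult_nth fps_add_nth
         fps_mult_left_const_nth fps_nth_fps_const fps_sub_nth nat.distinct(1))
  have n2: "complex_of_real ((cmod a)\<^sup>2) = a * cnj a" by (rule complex_norm_square)
  have a0: "fps_nth A 0 = a" by (simp add: a_def)
  have A1: "fps_nth A 1 = (1 - a * cnj a) * fps_nth P 0"
    using *[of 0] by (simp add: fps_mult_nth a0 algebra_simps)
  have "fps_nth A 2 = fps_nth P 1 - cnj a * (a * fps_nth P 1 + fps_nth A 1 * fps_nth P 0)"
    using *[of 1] by (simp add: fps_mult_nth a0 numeral_2_eq_2)
  then have A2: "fps_nth A 2 = (1 - a * cnj a) * (fps_nth P 1 - cnj a * (fps_nth P 0)\<^sup>2)"
    unfolding A1 by algebra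
  have "fps_nth A 3 = fps_nth P 2 - cnj a *
      (a * fps_nth P 2 + fps_nth A 1 * fps_nth P 1 + fps_nth A 2 * fps_nth P 0)"
    using *[of 2] by (simp add: fps_mult_nth a0 numeral_2_eq_2 numeral_3_eq_3)
  then have A3: "fps_nth A 3 = (1 - a * cnj a) *
       (fps_nth P 2 - 2 * cnj a * fps_nth P 0 * fps_nth P 1 + (cnj a)\<^sup>2 * fps_nth P 0 ^ 3)"
    unfolding A1 A2 by algebra
  show thesis using that[OF P] A1 A2 A3 unfolding of_real_diff of_real_1 n2 by blast
qed

text \<open>
  The first bound is immediate from a Schur step. In the second one the same bound for the first
  coefficient of the successor compensates its squared constant coefficient exactly.
\<close>

lemma schur_coeff_bounds:
  assumes "schur_series A"
  shows "cmod (fps_nth A 1) \<le> 1 - (cmod (fps_nth A 0))\<^sup>2"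
    and "cmod (fps_nth A 2) \<le> 1 - (cmod (fps_nth A 0))\<^sup>2"
proof -
  obtain P where P: "schur_series P"
    and A1: "fps_nth A 1 = (1 - (cmod (fps_nth A 0))\<^sup>2) * fps_nth P 0"
    and A2: "fps_nth A 2 = (1 - (cmod (fps_nth A 0))\<^sup>2) *
          (fps_nth P 1 - cnj (fps_nth A 0) * (fps_nth P 0)\<^sup>2)"
    using schur_coeffs[OF assms] by metis
  obtain Q where Q: "schur_series Q"
    and P1: "fps_nth P 1 = (1 - (cmod (fps_nth P 0))\<^sup>2) * fps_nth Q 0"
    using schur_coeffs[OF P] by metis
  have a: "cmod (fps_nth A 0) \<le> 1" and p: "cmod (fps_nth P 0) \<le> 1" and q: "cmod (fps_nth Q 0) \<le> 1"
    by (intro schur_series_nth_0_le assms P Q)+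
  have d: "0 \<le> 1 - (cmod (fps_nth A 0))\<^sup>2" "0 \<le> 1 - (cmod (fps_nth P 0))\<^sup>2" 
    using a p by (simp_all add: power_le_one)
  have nd: "cmod (1 - (complex_of_real r)\<^sup>2) = \<bar>1 - r\<^sup>2\<bar>" for r
    by (metis norm_of_real of_real_1 of_real_diff of_real_power)
  show "cmod (fps_nth A 1) \<le> 1 - (cmod (fps_nth A 0))\<^sup>2"
    using A1 p d by (simp add: norm_mult nd mult_left_le)
  have "cmod (fps_nth P 1 - cnj (fps_nth A 0) * (fps_nth P 0)\<^sup>2)
     \<le> cmod (fps_nth P 1) + cmod (fps_nth A 0) * (cmod (fps_nth P 0))\<^sup>2"
    using norm_triangle_ineq4[of "fps_nth P 1" "cnj (fps_nth A 0) * (fps_nth P 0)\<^sup>2"]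
    by (simp add: norm_mult norm_power)
  also have "\<dots> \<le> (1 - (cmod (fps_nth P 0))\<^sup>2) * 1 + 1 * (cmod (fps_nth P 0))\<^sup>2"
    using d q a unfolding P1 by (intro add_mono mult_right_mono) (simp_all add: norm_mult nd mult_left_le)
  finally have "cmod (fps_nth P 1 - cnj (fps_nth A 0) * (fps_nth P 0)\<^sup>2) \<le> 1" by simp
  then show "cmod (fps_nth A 2) \<le> 1 - (cmod (fps_nth A 0))\<^sup>2"
    using A2 d by (simp add: norm_mult nd mult_left_le)
qed

text \<open>
  A rotation \<open>u\<close> makes the first coefficient real and nonnegative. All coefficient functionals
  considered here are homogeneous under rotation, so \<open>u\<close> drops out of their moduli. The bounds on
  \<open>y\<close> and \<open>s\<close> are far from a full description of the possible coefficients, but they leave enough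
  room for the estimates below.
\<close>

lemma Schwarz_coeffs:
  assumes "w holomorphic_on unit_disc" "w 0 = 0" "\<And>z. cmod z < 1 \<Longrightarrow> cmod (w z) < 1"
    and W: "w has_fps_expansion W"
  obtains u x y s :: complex and r :: real
  where "cmod u = 1" "0 \<le> r" "r \<le> 1"
    "cmod x \<le> 1" "cmod y \<le> 1 - (cmod x)\<^sup>2" "cmod s \<le> 1 - (cmod x)\<^sup>2"
    "fps_nth W 1 = u * r"
    "fps_nth W 2 = u ^ 2 * ((1 - r\<^sup>2) * x)"
    "fps_nth W 3 = u ^ 3 * ((1 - r\<^sup>2) * (y - r * x\<^sup>2))"
    "fps_nth W 4 = u ^ 4 * ((1 - r\<^sup>2) * (s - 2 * r * x * y + r\<^sup>2 * x ^ 3))"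
proof -
  obtain A where A: "schur_series A" "w has_fps_expansion fps_X * A"
    by (rule divided_Schwarz_function[OF assms(1-3)])
  have WA: "W = fps_X * A" by (rule fps_expansion_unique_complex[OF W A(2)])
  define a where "a = fps_nth A 0"
  obtain P where P: "schur_series P"
    and A1: "fps_nth A 1 = (1 - (cmod a)\<^sup>2) * fps_nth P 0"
    and A2: "fps_nth A 2 = (1 - (cmod a)\<^sup>2) * (fps_nth P 1 - cnj a * (fps_nth P 0)\<^sup>2)"
    and A3: "fps_nth A 3 = (1 - (cmod a)\<^sup>2) *
       (fps_nth P 2 - 2 * cnj a * fps_nth P 0 * fps_nth P 1 + (cnj a)\<^sup>2 * fps_nth P 0 ^ 3)"
    using schur_coeffs[OF A(1)] unfolding a_def by metis
  define r where "r = cmod a"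
  \<comment> \<open>any unit serves when the first coefficient vanishes\<close>
  define u where "u = (if a = 0 then 1 else a / r)"
  have u1: "cmod u = 1" by (simp add: u_def r_def norm_divide)
  have au: "a = u * r" by (simp add: u_def r_def)
  have uu: "cnj u * u = 1" using u1 by (metis complex_norm_square mult.commute of_real_1 power_one)
  have ca: "cnj a = cnj u * r" by (simp add: au)
  have pu: "p = u ^ n * (cnj u ^ n * p)" for p n
    by (metis mult.assoc mult.commute mult_1 power_mult_distrib power_one uu)
  have nu: "cmod (cnj u ^ n * p) = cmod p" for n p
    by (simp add: norm_mult norm_power u1)
  \<comment> \<open>the rotated Schur data: the coefficient of order n of the rotated function carries u to the n\<close>
  define x where "x = cnj u ^ 2 * fps_nth P 0"
  define y where "y = cnj u ^ 3 * fps_nth P 1"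
  define s where "s = cnj u ^ 4 * fps_nth P 2"
  have px: "fps_nth P 0 = u ^ 2 * x" and py: "fps_nth P 1 = u ^ 3 * y" and ps: "fps_nth P 2 = u ^ 4 * s"
    unfolding x_def y_def s_def by (rule pu)+
  show thesis
  proof (rule that[of u r x y s])
    show "cmod u = 1" "0 \<le> r" by (simp_all add: u1 r_def)
    show "r \<le> 1" unfolding r_def a_def by (rule schur_series_nth_0_le[OF A(1)])
    show "cmod x \<le> 1" unfolding x_def nu by (rule schur_series_nth_0_le[OF P])
    show "cmod y \<le> 1 - (cmod x)\<^sup>2" "cmod s \<le> 1 - (cmod x)\<^sup>2"
      unfolding x_def y_def s_def nu by (rule schur_coeff_bounds[OF P])+
    show "fps_nth W 1 = u * r" by (simp add: WA au flip: a_def)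
    show "fps_nth W 2 = u ^ 2 * ((1 - r\<^sup>2) * x)"
      using A1 by (simp add: WA px flip: r_def)
    have "fps_nth W 3 = (1 - r\<^sup>2) * (u ^ 3 * y - cnj u * r * (u ^ 2 * x)\<^sup>2)"
      using A2 by (simp add: WA px py[simplified] ca flip: r_def)
    also have "\<dots> = u ^ 3 * ((1 - r\<^sup>2) * (y - r * x\<^sup>2))"
      using uu by algebra
    finally show "fps_nth W 3 = u ^ 3 * ((1 - r\<^sup>2) * (y - r * x\<^sup>2))" .
    have "fps_nth W 4 = (1 - r\<^sup>2) * (u ^ 4 * s - 2 * (cnj u * r) * (u ^ 2 * x) * (u ^ 3 * y)
        + (cnj u * r)\<^sup>2 * (u ^ 2 * x) ^ 3)"
      using A3 by (simp add: WA px py[simplified] ps ca flip: r_def)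
    also have "\<dots> = u ^ 4 * ((1 - r\<^sup>2) * (s - 2 * r * x * y + r\<^sup>2 * x ^ 3))"
      using uu by (simp only: of_real_mult of_real_power of_real_numeral) algebra
    finally show "fps_nth W 4 = u ^ 4 * ((1 - r\<^sup>2) * (s - 2 * r * x * y + r\<^sup>2 * x ^ 3))" .
  qed
qed

section \<open>The power series of the inverse\<close>

text \<open>
  If \<open>f\<close> solves \<open>z f' = f exp w\<close>, then substituting \<open>z = g u\<close> and using \<open>f' (g u) g' u = 1\<close> gives
  \<open>u g' exp (w \<circ> g) = g\<close>. This equation contains no coefficient of \<open>f\<close>, so the inverse
  coefficients follow directly from those of \<open>w\<close>.
\<close>

lemma inverse_series_equation:
  assumes f: "f holomorphic_on unit_disc" "f 0 = 0" "deriv f 0 = 1"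
    and w: "w 0 = 0" "w has_fps_expansion W"
    and quot: "\<forall>z\<in>unit_disc. starlike_quotient f z = exp (w z)"
    and inv: "local_inverse_at_0 f g" and A: "g has_fps_expansion A"
  shows "fps_nth A 0 = 0" and "fps_nth A 1 = 1"
    and "fps_X * fps_deriv A * (fps_exp 1 oo (W oo A)) = A"
proof -
  have g0: "g 0 = 0" using inv by (simp add: local_inverse_at_0_def)
  show A0: "fps_nth A 0 = 0"
    using has_fps_expansion_imp_0_eq_fps_nth_0[OF A] g0 by simp
  have W0: "fps_nth W 0 = 0"
    using has_fps_expansion_imp_0_eq_fps_nth_0[OF w(2)] w(1) by simp
  obtain U V where UV: "U \<subseteq> unit_disc" "open V" "0 \<in> V" "homeomorphism U V f g"
    using inv unfolding local_inverse_at_0_def by blast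
  obtain S where S: "open S" "0 \<in> S" "g holomorphic_on S"
    using has_fps_expansion_imp_holomorphic[OF A] by metis
  define T where "T = S \<inter> V"
  have T: "open T" "0 \<in> T" using S UV by (auto simp: T_def)
  have gU: "g u \<in> unit_disc" and fg: "f (g u) = u" if "u \<in> T" for u
    using UV that unfolding T_def homeomorphism_def by blast+
  have chain: "deriv f (g u) * deriv g u = 1" if u: "u \<in> T" for u
  proof -
    have "(f has_field_derivative deriv f (g u)) (at (g u))"
      by (rule holomorphic_derivI[OF f(1)]) (use gU[OF u] in auto)
    moreover have "(g has_field_derivative deriv g u) (at u)"
      by (rule holomorphic_derivI[OF S(3,1)]) (use u in \<open>auto simp: T_def\<close>)
    ultimately have "(f \<circ> g has_field_derivative deriv f (g u) * deriv g u) (at u)"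
      by (rule DERIV_chain)
    then have "((\<lambda>u. u) has_field_derivative deriv f (g u) * deriv g u) (at u)"
      by (rule has_field_derivative_transform_within_open[OF _ T(1) u]) (simp add: fg)
    then show ?thesis using DERIV_ident DERIV_unique by blast
  qed
  have "deriv g 0 = 1" using chain[OF T(2)] g0 f(3) by simp
  then show "fps_nth A 1 = 1"
    by (simp add: fps_nth_fps_expansion[OF A])
  have eq: "u * deriv g u * exp (w (g u)) = g u" if u: "u \<in> T" for u
  proof (cases "u = 0")
    case False
    have nz: "g u \<noteq> 0" using False fg[OF u] f(2) by auto
    have "g u * deriv f (g u) = u * exp (w (g u))"
      using bspec[OF quot gU[OF u]] nz False fg[OF u] by (simp add: starlike_quotient_def field_simps)
    then have "u * deriv g u * exp (w (g u)) = g u * (deriv f (g u) * deriv g u)"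
      by (simp add: mult_ac)
    then show ?thesis using chain[OF u] by simp
  qed (use g0 in simp)
  have "(exp \<circ> (w \<circ> g)) has_fps_expansion (fps_exp 1 oo (W oo A))"
    by (intro has_fps_expansion_compose has_fps_expansion_exp1 w A) (simp_all add: A0 W0)
  then have "(\<lambda>u. u * deriv g u * (exp \<circ> (w \<circ> g)) u) has_fps_expansion
      fps_X * fps_deriv A * (fps_exp 1 oo (W oo A))"
    by (intro has_fps_expansion_mult has_fps_expansion_fps_X has_fps_expansion_deriv A)
  moreover have "\<forall>\<^sub>F u in nhds 0. u * deriv g u * (exp \<circ> (w \<circ> g)) u = g u"
    using eventually_nhds_in_open[OF T] by eventually_elim (simp add: eq)
  ultimately show "fps_X * fps_deriv A * (fps_exp 1 oo (W oo A)) = A"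
    using A fps_expansion_unique_complex has_fps_expansion_cong by metis
qed

text \<open>
  Comparing coefficients in the equation determines \<open>A\<close> recursively: the coefficient
  of order \<open>n\<close> occurs with total factor \<open>n - 1\<close>.
\<close>

lemma inverse_coeffs_fps:
  fixes A W :: "complex fps"
  assumes ode: "fps_X * fps_deriv A * (fps_exp 1 oo (W oo A)) = A"
    and A0: "fps_nth A 0 = 0" and A1: "fps_nth A 1 = 1" and W0: "fps_nth W 0 = 0"
  defines "c \<equiv> fps_nth W"
  shows "fps_nth A 2 = - c 1"
    and "fps_nth A 3 = - c 2 / 2 + 5/4 * c 1 ^ 2"
    and "fps_nth A 4 = - c 3 / 3 + 5/3 * c 1 * c 2 - 31/18 * c 1 ^ 3"
    and "fps_nth A 5 = - c 4 / 4 + 17/12 * c 1 * c 3 + c 2 ^ 2 / 2 - 49/12 * c 1 ^ 2 * c 2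
                         + 361/144 * c 1 ^ 4"
proof -
  define V where "V = W oo A"
  define E where "E = fps_exp 1 oo V"
  note num = numeral_2_eq_2 numeral_3_eq_3 eval_nat_numeral
  have V0: "fps_nth V 0 = 0" by (simp add: V_def W0)
  have A1': "fps_nth A (Suc 0) = 1" using A1 by simp
  have V1: "fps_nth V (Suc 0) = c 1"
    by (simp add: V_def c_def fps_compose_nth A0 A1' W0)
  have V2: "fps_nth V (Suc (Suc 0)) = c 1 * fps_nth A 2 + c 2"
    by (simp add: V_def c_def fps_compose_nth A0 A1' W0 fps_mult_nth num algebra_simps)
  have V3: "fps_nth V (Suc (Suc (Suc 0))) = c 1 * fps_nth A 3 + 2 * c 2 * fps_nth A 2 + c 3"
    by (simp add: V_def c_def fps_compose_nth A0 A1' W0 fps_mult_nth num algebra_simps)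
  have V4: "fps_nth V (Suc (Suc (Suc (Suc 0)))) =
      c 1 * fps_nth A 4 + c 2 * (2 * fps_nth A 3 + fps_nth A 2 ^ 2)
      + 3 * c 3 * fps_nth A 2 + c 4"
    by (simp add: V_def c_def fps_compose_nth A0 A1' W0 fps_mult_nth num algebra_simps)
  have E0: "fps_nth E 0 = 1" by (simp add: E_def)
  have E1: "fps_nth E (Suc 0) = fps_nth V 1"
    by (simp add: E_def fps_compose_nth V0)
  have E2: "fps_nth E (Suc (Suc 0)) = fps_nth V 2 + fps_nth V 1 ^ 2 / 2"
    by (simp add: E_def fps_compose_nth V0 fps_mult_nth num algebra_simps)
  have E3: "fps_nth E (Suc (Suc (Suc 0))) =
      fps_nth V 3 + fps_nth V 1 * fps_nth V 2 + fps_nth V 1 ^ 3 / 6"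
    by (simp add: E_def fps_compose_nth V0 fps_mult_nth num algebra_simps)
  have E4: "fps_nth E (Suc (Suc (Suc (Suc 0)))) = fps_nth V 4 + fps_nth V 1 * fps_nth V 3
     + fps_nth V 2 ^ 2 / 2 + fps_nth V 1 ^ 2 * fps_nth V 2 / 2 + fps_nth V 1 ^ 4 / 24"
    by (simp add: E_def fps_compose_nth V0 fps_mult_nth num algebra_simps)
  have rec: "fps_nth A (Suc n) = (\<Sum>i=0..n. of_nat (Suc i) * fps_nth A (Suc i) * fps_nth E (n - i))"
    for n
  proof -
    have "fps_nth A (Suc n) = fps_nth (fps_X * (fps_deriv A * E)) (Suc n)"
      using ode by (simp add: E_def V_def mult.assoc)
    also have "\<dots> = fps_nth (fps_deriv A * E) n"
      unfolding fps_X_mult_nth by simp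
    finally show ?thesis by (simp add: fps_mult_nth del: of_nat_Suc)
  qed
  \<comment> \<open>in each order the top coefficient of A occurs on both sides, once with factor 1 and once with factor n\<close>
  have A2: "fps_nth A 2 = - fps_nth E 1"
    using rec[of 1] by (simp add: A1' E0 num) algebra
  have "fps_nth A 3 = fps_nth E 2 + 2 * fps_nth A 2 * fps_nth E 1 + 3 * fps_nth A 3"
    using rec[of 2] by (simp add: A1' E0 num mult_ac add_ac)
  then have "2 * fps_nth A 3 = - (fps_nth E 2 + 2 * fps_nth A 2 * fps_nth E 1)"
    by algebra
  then have A3: "fps_nth A 3 = - (fps_nth E 2 + 2 * fps_nth A 2 * fps_nth E 1) / 2"
    by (simp add: field_simps)
  have "fps_nth A 4 = fps_nth E 3 + 2 * fps_nth A 2 * fps_nth E 2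
      + 3 * fps_nth A 3 * fps_nth E 1 + 4 * fps_nth A 4"
    using rec[of 3] by (simp add: A1' E0 num mult_ac add_ac)
  then have "3 * fps_nth A 4 = - (fps_nth E 3 + 2 * fps_nth A 2 * fps_nth E 2
      + 3 * fps_nth A 3 * fps_nth E 1)"
    by algebra
  then have A4: "fps_nth A 4 = - (fps_nth E 3 + 2 * fps_nth A 2 * fps_nth E 2
      + 3 * fps_nth A 3 * fps_nth E 1) / 3"
    by (simp add: field_simps)
  have "fps_nth A 5 = fps_nth E 4 + 2 * fps_nth A 2 * fps_nth E 3
      + 3 * fps_nth A 3 * fps_nth E 2 + 4 * fps_nth A 4 * fps_nth E 1 + 5 * fps_nth A 5"
    using rec[of 4] by (simp add: A1' E0 num mult_ac add_ac)
  then have "4 * fps_nth A 5 = - (fps_nth E 4 + 2 * fps_nth A 2 * fps_nth E 3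
      + 3 * fps_nth A 3 * fps_nth E 2 + 4 * fps_nth A 4 * fps_nth E 1)"
    by algebra
  then have A5: "fps_nth A 5 = - (fps_nth E 4 + 2 * fps_nth A 2 * fps_nth E 3
      + 3 * fps_nth A 3 * fps_nth E 2 + 4 * fps_nth A 4 * fps_nth E 1) / 4"
    by (simp add: field_simps)
  note V = V1 V2 V3 V4 and E = E1 E2 E3 E4
  have nums: "(1::nat) = Suc 0" "(2::nat) = Suc (Suc 0)" "(3::nat) = Suc (Suc (Suc 0))"
    "(4::nat) = Suc (Suc (Suc (Suc 0)))"
    by simp_all
  note EV = E[folded nums] V[folded nums]
  show c2: "fps_nth A 2 = - c 1"
    using A2 E1 V1 by simp
  show c3: "fps_nth A 3 = - c 2 / 2 + 5/4 * c 1 ^ 2"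
    unfolding A3 c2 EV
    by (simp add: power2_eq_square field_simps)
  show c4: "fps_nth A 4 = - c 3 / 3 + 5/3 * c 1 * c 2 - 31/18 * c 1 ^ 3"
    unfolding A4 c3 c2 EV
    by (simp add: power2_eq_square power3_eq_cube field_simps)
  show c5: "fps_nth A 5 = - c 4 / 4 + 17/12 * c 1 * c 3 + c 2 ^ 2 / 2 - 49/12 * c 1 ^ 2 * c 2
                         + 361/144 * c 1 ^ 4"
    unfolding A5 c4 c3 c2 EV
    by (simp add: power2_eq_square power3_eq_cube power4_eq_xxxx field_simps)
qed

lemma class_S_e_coeff_formulas:
  assumes f: "f holomorphic_on unit_disc" "f 0 = 0" "deriv f 0 = 1"
    and w: "w 0 = 0" "w has_fps_expansion W"
    and quot: "\<forall>z\<in>unit_disc. starlike_quotient f z = exp (w z)"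
    and A: "inverse_expansion f A"
  defines "c \<equiv> fps_nth W"
  shows "fps_nth A 2 = - c 1"
    and "fps_nth A 3 = - c 2 / 2 + 5/4 * c 1 ^ 2"
    and "fps_nth A 4 = - c 3 / 3 + 5/3 * c 1 * c 2 - 31/18 * c 1 ^ 3"
    and "fps_nth A 5 = - c 4 / 4 + 17/12 * c 1 * c 3 + c 2 ^ 2 / 2 - 49/12 * c 1 ^ 2 * c 2
                         + 361/144 * c 1 ^ 4"
proof -
  obtain g where g: "local_inverse_at_0 f g" "g has_fps_expansion A"
    using A unfolding inverse_expansion_def by blast
  note eq = inverse_series_equation[OF f w quot g]
  have "fps_nth W 0 = 0"
    using has_fps_expansion_imp_0_eq_fps_nth_0[OF w(2)] w(1) by simp
  note * = inverse_coeffs_fps[OF eq(3) eq(1) eq(2) this, folded c_def]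
  show "fps_nth A 2 = - c 1"
    and "fps_nth A 3 = - c 2 / 2 + 5/4 * c 1 ^ 2"
    and "fps_nth A 4 = - c 3 / 3 + 5/3 * c 1 * c 2 - 31/18 * c 1 ^ 3"
    and "fps_nth A 5 = - c 4 / 4 + 17/12 * c 1 * c 3 + c 2 ^ 2 / 2 - 49/12 * c 1 ^ 2 * c 2
                         + 361/144 * c 1 ^ 4"
    by (rule *)+
qed

section \<open>Estimates of the coefficient functionals\<close>

text \<open>
  The value is a convex combination with weights \<open>1 - r\<^sup>2\<close> and \<open>r\<^sup>2\<close> of numbers of modulus at most
  1/2 and 5/4.
\<close>

lemma third_coeff_bound:
  fixes r :: real and x :: complex
  assumes r: "0 \<le> r" "r \<le> 1" and x: "cmod x \<le> 1"
  shows "cmod (- ((1 - r\<^sup>2) * x) / 2 + 5/4 * r ^ 2) \<le> 5/4"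
proof -
  have "cmod (- ((1 - r\<^sup>2) * x) / 2 + 5/4 * r ^ 2)
      \<le> cmod (- ((1 - r\<^sup>2) * x) / 2) + cmod (5/4 * r ^ 2)"
    by (rule norm_triangle_ineq)
  also have "\<dots> = \<bar>1 - r\<^sup>2\<bar> * cmod x / 2 + \<bar>5/4 * r\<^sup>2\<bar>"
    by (simp only: norm_divide norm_minus_cancel norm_mult norm_of_real norm_numeral)
  also have "\<dots> = (1 - r\<^sup>2) * cmod x / 2 + 5/4 * r\<^sup>2"
    using power_le_one[OF r, of 2] by simp
  also have "\<dots> \<le> 5/4"
  proof -
    have r2: "r\<^sup>2 \<le> 1" using r by (simp add: power_le_one)
    have "(1 - r\<^sup>2) * cmod x \<le> 1 - r\<^sup>2" using r2 x by (simp add: mult_left_le)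
    then show ?thesis using r2 by linarith
  qed
  finally show ?thesis .
qed

text \<open>
  The triangle inequality is good enough here: after multiplication by 3 the terms with \<open>x\<close> and \<open>y\<close>
  cost at most \<open>(1 - r\<^sup>2) * (1 + 6 * r)\<close>, which is at most the gap \<open>31/6 * (1 - r ^ 3)\<close>.
\<close>

lemma fourth_coeff_bound:
  fixes r :: real and x y :: complex
  assumes r: "0 \<le> r" "r \<le> 1" and x: "cmod x \<le> 1" and y: "cmod y \<le> 1 - (cmod x)\<^sup>2"
  shows "cmod (- ((1 - r\<^sup>2) * (y - r * x\<^sup>2)) / 3 + 5/3 * r * ((1 - r\<^sup>2) * x)
      - 31/18 * r ^ 3) \<le> 31/18"
proof -
  define t where "t = cmod x"
  have t: "0 \<le> t" "t \<le> 1" using x by (auto simp: t_def)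
  define d where "d = 1 - r\<^sup>2"
  have d: "0 \<le> d" using r by (simp add: d_def power_le_one)
  have "cmod (y - r * x\<^sup>2 - 5 * r * x) \<le> cmod y + r * t\<^sup>2 + 5 * r * t"
    using norm_triangle_ineq4[of "y - r * x\<^sup>2" "5 * r * x"] norm_triangle_ineq4[of y "r * x\<^sup>2"] r
    by (simp add: norm_mult norm_power t_def)
  also have "\<dots> \<le> 1 - t\<^sup>2 + r * t\<^sup>2 + 5 * r * t"
    using y by (simp add: t_def)
  also have "\<dots> \<le> 1 + 6 * r"
  proof -
    have "r * t\<^sup>2 \<le> r * 1" "5 * r * t \<le> 5 * r * 1"
      using r t by (intro mult_left_mono; simp add: power_le_one)+
    then show ?thesis by (smt (verit) zero_le_power2)
  qed
  finally have b: "cmod (y - r * x\<^sup>2 - 5 * r * x) \<le> 1 + 6 * r" .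
  have eq: "- (d * (y - r * x\<^sup>2)) / 3 + 5/3 * r * (d * x) - 31/18 * r ^ 3
      = - (d * (y - r * x\<^sup>2 - 5 * r * x) + 31/6 * r ^ 3) / 3"
    by (simp add: field_simps)
  have "cmod (- (d * (y - r * x\<^sup>2)) / 3 + 5/3 * r * (d * x) - 31/18 * r ^ 3)
      = cmod (d * (y - r * x\<^sup>2 - 5 * r * x) + 31/6 * r ^ 3) / 3"
    unfolding eq by (simp only: norm_divide norm_minus_cancel) simp
  also have "\<dots> \<le> (d * cmod (y - r * x\<^sup>2 - 5 * r * x) + 31/6 * r ^ 3) / 3"
    using norm_triangle_ineq[of "d * (y - r * x\<^sup>2 - 5 * r * x)" "31/6 * r ^ 3"] r d
    by (simp add: norm_mult norm_power)
  also have "\<dots> \<le> (d * (1 + 6 * r) + 31/6 * r ^ 3) / 3"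
    using b d by (intro divide_right_mono add_mono mult_left_mono) auto
  also have "\<dots> \<le> 31/18"
  proof -
    \<comment> \<open>factoring out 1 - r turns the claim into 31/6 * (1 + r + r^2) >= (1 + r) * (1 + 6 * r)\<close>
    have "0 \<le> (1 - r) * (25/6 - 11/6 * r - 5/6 * r\<^sup>2)"
      using r power_le_one[OF r, of 2] by (intro mult_nonneg_nonneg) auto
    also have "\<dots> = 31/6 - (d * (1 + 6 * r) + 31/6 * r ^ 3)"
      by (simp add: d_def power2_eq_square power3_eq_cube field_simps)
    finally show ?thesis by simp
  qed
  finally show ?thesis by (simp add: d_def)
qed

text \<open>
  If \<open>H\<close> is larger than the budget \<open>B\<close>, the triangle inequality is not good enough. But for small
  \<open>d\<close> the modulus of \<open>d * H - K\<close> grows to first order only with \<open>- Re H\<close>, and \<open>cmod H\<close> enters at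
  second order. The alternative hypothesis is the squared inequality with a factor \<open>d\<close> removed.
\<close>

lemma norm_scaled_minus_real_le:
  fixes H :: complex and K d B :: real
  assumes "0 \<le> K" "0 \<le> d" "0 \<le> K + d * B"
    and "cmod H \<le> B \<or> 2 * K * (- Re H - B) + d * ((cmod H)\<^sup>2 - B\<^sup>2) \<le> 0"
  shows "cmod (d * H - K) \<le> K + d * B"
  using assms(4)
proof
  assume "cmod H \<le> B"
  then have "d * cmod H \<le> d * B" using assms by (intro mult_left_mono)
  then show ?thesis
    using norm_triangle_ineq4[of "d * H" K] assms by (simp add: norm_mult)
next
  assume *: "2 * K * (- Re H - B) + d * ((cmod H)\<^sup>2 - B\<^sup>2) \<le> 0"
  have "(cmod (d * H - K))\<^sup>2 = (K + d * B)\<^sup>2 + d * (2 * K * (- Re H - B) + d * ((cmod H)\<^sup>2 - B\<^sup>2))"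
    unfolding cmod_power2 by (simp add: power2_eq_square algebra_simps)
  also have "\<dots> \<le> (K + d * B)\<^sup>2"
    using * assms(2) by (simp add: mult_nonneg_nonpos)
  finally show ?thesis using assms(3) by (rule power2_le_imp_le)
qed

text \<open>
  Tangents at 1, where the polynomial inequalities below are tightest.
\<close>

lemma tangent_bounds:
  fixes t :: real
  assumes "0 \<le> t"
  shows "2 * t - 1 \<le> t\<^sup>2" and "3 * t - 2 \<le> t ^ 3"
proof -
  show "2 * t - 1 \<le> t\<^sup>2" using zero_le_power2[of "t - 1"] by (simp add: power2_eq_square algebra_simps)
  have "0 \<le> (t - 1)\<^sup>2 * (t + 2)" using assms by simp
  then show "3 * t - 2 \<le> t ^ 3" by (simp add: power2_eq_square power3_eq_cube algebra_simps)
qed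

text \<open>
  For \<open>r\<^sup>2 \<le> 4/5\<close> the term \<open>H\<close> in the bound for the fifth coefficient stays within its budget. The
  threshold is nearly the largest possible: at \<open>r\<^sup>2 = 4/5\<close> and \<open>t = 1\<close> the two sides are 18 and
  18.05.
\<close>

lemma small_modulus_estimate:
  fixes r t :: real
  assumes r: "r\<^sup>2 \<le> 4/5" and t: "0 \<le> t" "t \<le> 1"
  shows "r\<^sup>2 * t ^ 3 + \<bar>23/3 * r\<^sup>2 - 2\<bar> * t\<^sup>2 + 49/3 * r\<^sup>2 * t
     \<le> 361/36 * (1 + r\<^sup>2) - (1 - t\<^sup>2) * (1 + 2 * r * t + 17/3 * r)"
proof -
  define v where "v = r\<^sup>2"
  have v: "0 \<le> v" "v \<le> 4/5" using r by (simp_all add: v_def)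
  have t2: "0 \<le> t\<^sup>2" "t\<^sup>2 \<le> 1" and t3: "0 \<le> t ^ 3" "t ^ 3 \<le> 1" using t by (simp_all add: power_le_one)
  \<comment> \<open>this linear bound in v makes everything below affine in v, so the ends v = 0 and v = 4/5 suffice\<close>
  have rv: "r \<le> (1 + v) / 2"
    using zero_le_power2[of "r - 1"] by (simp add: v_def power2_eq_square algebra_simps)
  have "(1 - t\<^sup>2) * (1 + r * (2 * t + 17/3)) \<le> (1 - t\<^sup>2) * (1 + (1 + v) / 2 * (2 * t + 17/3))"
    using rv t t2 by (intro mult_left_mono add_left_mono mult_right_mono) auto
  then have R: "(1 - t\<^sup>2) * (1 + 2 * r * t + 17/3 * r) \<le> (1 - t\<^sup>2) * (1 + (1 + v) / 2 * (2 * t + 17/3))"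
    by (simp add: algebra_simps)
  \<comment> \<open>the two signs stand for the absolute value\<close>
  have main: "0 \<le> 361/36 * (1 + v) - (1 - t\<^sup>2) * (1 + (1 + v) / 2 * (2 * t + 17/3))
          - (v * t ^ 3 + \<sigma> * (23/3 * v - 2) * t\<^sup>2 + 49/3 * v * t)" if \<sigma>: "\<sigma> = 1 \<or> \<sigma> = -1" for \<sigma>
  proof -
    define f0 where "f0 = 361/36 - (1 - t\<^sup>2) * (1 + (2 * t + 17/3) / 2) + 2 * \<sigma> * t\<^sup>2"
    define f1 where "f1 = 361/36 * (9/5) - (1 - t\<^sup>2) * (1 + 9/10 * (2 * t + 17/3))
        - (4/5 * t ^ 3 + 62/15 * \<sigma> * t\<^sup>2 + 49/3 * (4/5) * t)"
    have "f0 = 223/36 - t + (23/6 + 2 * \<sigma>) * t\<^sup>2 + t ^ 3"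
      unfolding f0_def by (simp add: field_simps power2_eq_square power3_eq_cube)
    then have f0: "0 \<le> f0"
      using \<sigma> t t2 t3 by auto
    have f1_eq: "f1 = 239/20 - 223/15 * t + (61/10 - 62/15 * \<sigma>) * t\<^sup>2 + t ^ 3"
      unfolding f1_def by (simp add: field_simps power2_eq_square power3_eq_cube)
    have f1: "0 \<le> f1"
      using \<sigma> t t2 t3 tangent_bounds[OF t(1)] unfolding f1_eq by auto
    have "0 \<le> (1 - 5/4 * v) * f0 + 5/4 * v * f1"
      using f0 f1 v by (intro add_nonneg_nonneg mult_nonneg_nonneg) auto
    also have "\<dots> = 361/36 * (1 + v) - (1 - t\<^sup>2) * (1 + (1 + v) / 2 * (2 * t + 17/3))
          - (v * t ^ 3 + \<sigma> * (23/3 * v - 2) * t\<^sup>2 + 49/3 * v * t)"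
      unfolding f0_def f1_def by (simp add: field_simps power2_eq_square power3_eq_cube)
    finally show ?thesis .
  qed
  show ?thesis
    using main[of 1] main[of "-1"] R unfolding v_def[symmetric] 
    by (cases "0 \<le> 23/3 * v - 2") (simp_all add: abs_if)
qed

text \<open>
  For \<open>r\<^sup>2 \<ge> 4/5\<close> the two polynomials in \<open>t\<close> bound \<open>- Re H\<close> and \<open>cmod H\<close>. The weights come from
  \<open>2 * K \<ge> 64/5\<close> and \<open>d * (cmod H + B) \<le> 46/5\<close>, and 22 is their sum.
\<close>

lemma large_modulus_estimate:
  fixes r t :: real
  assumes r: "r \<le> 1" "4/5 \<le> r\<^sup>2" and t: "0 \<le> t" "t \<le> 1"
  defines "B \<equiv> 361/36 * (1 + r\<^sup>2) - (1 - t\<^sup>2) * (1 + 2 * r * t + 17/3 * r)"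
  shows "t ^ 3 + 17/3 * t\<^sup>2 + 6 \<le> B"
    and "64/5 * (t ^ 3 + 17/3 * t\<^sup>2 + 6) + 46/5 * (t ^ 3 + 17/3 * t\<^sup>2 + 49/3 * t) \<le> 22 * B"
proof -
  have t2: "0 \<le> t\<^sup>2" "t\<^sup>2 \<le> 1" and t3: "0 \<le> t ^ 3" "t ^ 3 \<le> 1" using t by (simp_all add: power_le_one)
  have "(1 - t\<^sup>2) * (1 + r * (2 * t + 17/3)) \<le> (1 - t\<^sup>2) * (1 + 1 * (2 * t + 17/3))"
    using r t t2 by (intro mult_left_mono add_left_mono mult_right_mono) auto
  then have "(1 - t\<^sup>2) * (1 + 2 * r * t + 17/3 * r) \<le> (1 - t\<^sup>2) * (20/3 + 2 * t)"
    by (simp add: algebra_simps)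
  moreover have "361/20 \<le> 361/36 * (1 + r\<^sup>2)" using r(2) by simp
  ultimately have B: "361/20 - (1 - t\<^sup>2) * (20/3 + 2 * t) \<le> B"
    unfolding B_def by linarith
  have e: "(1 - t\<^sup>2) * (20/3 + 2 * t) = 20/3 + 2 * t - 20/3 * t\<^sup>2 - 2 * t ^ 3"
    by (simp add: field_simps power2_eq_square power3_eq_cube)
  show "t ^ 3 + 17/3 * t\<^sup>2 + 6 \<le> B"
    using B t t2 t3 unfolding e by linarith
  show "64/5 * (t ^ 3 + 17/3 * t\<^sup>2 + 6) + 46/5 * (t ^ 3 + 17/3 * t\<^sup>2 + 49/3 * t) \<le> 22 * B"
  proof -
    have "64/5 * (t ^ 3 + 17/3 * t\<^sup>2 + 6) + 46/5 * (t ^ 3 + 17/3 * t\<^sup>2 + 49/3 * t)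
        = 22 * t ^ 3 + 374/3 * t\<^sup>2 + 2254/15 * t + 384/5"
      by (simp add: field_simps)
    also have "\<dots> \<le> 22 * (361/20 - (20/3 + 2 * t - 20/3 * t\<^sup>2 - 2 * t ^ 3))"
      using t tangent_bounds[OF t(1)] by argo
    also have "\<dots> \<le> 22 * B" using B unfolding e by simp
    finally show ?thesis .
  qed
qed

text \<open>
  With \<open>v = r\<^sup>2\<close> the argument of \<open>Re\<close> is the \<open>H\<close> of the fifth coefficient. Its real part becomes
  negative mainly through the linear term, and there the quadratic term has the opposite sign. This
  cancellation, invisible to the triangle inequality, replaces \<open>49/3 * cmod x\<close> by 6.
\<close>

lemma Re_lower_bound:
  fixes v :: real and x :: complex
  assumes v: "4/5 \<le> v" "v \<le> 1" 
  shows "- Re (v * x ^ 3 + (23/3 * v - 2) * x\<^sup>2 + 49/3 * v * x)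
    \<le> cmod x ^ 3 + 17/3 * (cmod x)\<^sup>2 + 6"
proof -
  define p q a where "p = 23/3 * v - 2" and "q = 49/3 * v" and "a = Re x"
  have p: "0 < p" "p \<le> 17/3" using v by (simp_all add: p_def)
  have x3: "- (v * Re (x ^ 3)) \<le> cmod x ^ 3"
  proof -
    have "- (v * Re (x ^ 3)) \<le> \<bar>v\<bar> * \<bar>Re (x ^ 3)\<bar>" by (metis abs_ge_minus_self abs_mult)
    also have "\<dots> \<le> 1 * cmod (x ^ 3)"
      using v abs_Re_le_cmod[of "x ^ 3"] by (intro mult_mono) auto
    finally show ?thesis by (simp add: norm_power)
  qed
  have x2: "Re (x\<^sup>2) = 2 * a\<^sup>2 - (cmod x)\<^sup>2"
    unfolding cmod_power2 a_def by (simp add: power2_eq_square)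
  \<comment> \<open>the quadratic 2 p a^2 + q a + 6 is nonnegative, since its discriminant is at most 0\<close>
  have "0 \<le> (4 * p * a + q)\<^sup>2 + (48 * p - q\<^sup>2)"
  proof -
    have "0 \<le> (v - 4/5) * (1 - v)" using v by simp
    then have "q\<^sup>2 \<le> 48 * p" using v by (simp add: p_def q_def power2_eq_square field_simps)
    then show ?thesis by simp
  qed
  also have "\<dots> = 8 * p * (2 * p * a\<^sup>2 + q * a + 6)"
    by (simp add: power2_eq_square algebra_simps)
  finally have "0 \<le> 2 * p * a\<^sup>2 + q * a + 6"
    using p by (simp add: zero_le_mult_iff)
  moreover have "p * (cmod x)\<^sup>2 \<le> 17/3 * (cmod x)\<^sup>2"
    using p by (intro mult_right_mono) auto
  moreover have "Re (v * x ^ 3 + (23/3 * v - 2) * x\<^sup>2 + 49/3 * v * x)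
      = v * Re (x ^ 3) + p * Re (x\<^sup>2) + q * a"
  proof -
    have "v * x ^ 3 + (23/3 * v - 2) * x\<^sup>2 + 49/3 * v * x
        = of_real v * x ^ 3 + of_real p * x\<^sup>2 + of_real q * x"
      by (simp add: p_def q_def)
    then show ?thesis
      by (simp only: plus_complex.sel Re_complex_of_real Im_complex_of_real times_complex.sel)
        (simp add: a_def)
  qed
  ultimately show ?thesis using x3 unfolding x2 by (simp add: algebra_simps)
qed

text \<open>
  The extremal value belongs to \<open>r = 1\<close>, and near it the triangle inequality fails: at \<open>x = 1\<close> the
  other terms have modulus about \<open>23 * d\<close> with \<open>d = 1 - r\<^sup>2\<close>, and the main term loses only about
  \<open>361/18 * d\<close> (all values multiplied by 4). There, however, the other terms have the
  sign opposite to that of the main term; so for \<open>r\<close> near 1 only their real part counts at first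
  order. Away from \<open>r = 1\<close> the triangle inequality suffices.
\<close>

lemma fifth_coeff_bound:
  fixes r :: real and x y s :: complex
  assumes r: "0 \<le> r" "r \<le> 1" and x: "cmod x \<le> 1"
    and y: "cmod y \<le> 1 - (cmod x)\<^sup>2" and s: "cmod s \<le> 1 - (cmod x)\<^sup>2"
  shows "cmod (- ((1 - r\<^sup>2) * (s - 2 * r * x * y + r\<^sup>2 * x ^ 3)) / 4
           + 17/12 * r * ((1 - r\<^sup>2) * (y - r * x\<^sup>2)) + ((1 - r\<^sup>2) * x)\<^sup>2 / 2
           - 49/12 * r\<^sup>2 * ((1 - r\<^sup>2) * x) + 361/144 * r ^ 4) \<le> 361/144"
    (is "cmod ?A \<le> _")
proof -
  define t where "t = cmod x"
  have t: "0 \<le> t" "t \<le> 1" using x by (auto simp: t_def)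
  define d where "d = 1 - r\<^sup>2"
  have d: "0 \<le> d" using r by (simp add: d_def power_le_one)
  \<comment> \<open>-4 times the expression is d (s - (2 r x + 17/3 r) y) + (d H - K); the y and s part is at most
    d (1 - t^2) M, and K + d B is what then remains of 361/36\<close>
  define K where "K = 361/36 * r ^ 4"
  define M where "M = 1 + 2 * r * t + 17/3 * r"
  define B where "B = 361/36 * (1 + r\<^sup>2) - (1 - t\<^sup>2) * M"
  define H where "H = r\<^sup>2 * x ^ 3 + (23/3 * r\<^sup>2 - 2) * x\<^sup>2 + 49/3 * r\<^sup>2 * x"
  have K0: "0 \<le> K" by (simp add: K_def)
  have cH: "cmod H \<le> r\<^sup>2 * t ^ 3 + \<bar>23/3 * r\<^sup>2 - 2\<bar> * t\<^sup>2 + 49/3 * r\<^sup>2 * t"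
  proof -
    have H_eq: "H = of_real (r\<^sup>2) * x ^ 3 + of_real (23/3 * r\<^sup>2 - 2) * x\<^sup>2
        + of_real (49/3 * r\<^sup>2) * x"
      by (simp add: H_def)
    have "cmod H \<le> cmod (of_real (r\<^sup>2) * x ^ 3) + cmod (of_real (23/3 * r\<^sup>2 - 2) * x\<^sup>2)
        + cmod (of_real (49/3 * r\<^sup>2) * x)"
      unfolding H_eq by (rule norm_triangle_mono[OF norm_triangle_ineq order_refl])
    also have "\<dots> = r\<^sup>2 * t ^ 3 + \<bar>23/3 * r\<^sup>2 - 2\<bar> * t\<^sup>2 + 49/3 * r\<^sup>2 * t"
      unfolding norm_mult norm_of_real norm_power t_def by simp
    finally show ?thesis .
  qed
  have alt: "0 \<le> B \<and> (cmod H \<le> B \<or> 2 * K * (- Re H - B) + d * ((cmod H)\<^sup>2 - B\<^sup>2) \<le> 0)"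
  proof (cases "r\<^sup>2 \<le> 4/5")
    case True
    then have "cmod H \<le> B"
      using small_modulus_estimate[OF True t] cH unfolding B_def M_def by linarith
    then show ?thesis using norm_ge_zero order_trans by blast
  next
    case False
    then have r2: "4/5 \<le> r\<^sup>2" "r\<^sup>2 \<le> 1" using r by (simp_all add: power_le_one)
    define D where "D = t ^ 3 + 17/3 * t\<^sup>2 + 6"
    define h where "h = t ^ 3 + 17/3 * t\<^sup>2 + 49/3 * t"
    have DB: "D \<le> B" and DhB: "64/5 * D + 46/5 * h \<le> 22 * B"
      using large_modulus_estimate[OF r(2) r2(1) t] unfolding B_def M_def D_def h_def by simp_all
    have ReH: "- Re H \<le> D"
      using Re_lower_bound[OF r2] unfolding H_def D_def t_def by simp
    have Hh: "cmod H \<le> h"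
    proof -
      have "r\<^sup>2 * t ^ 3 \<le> 1 * t ^ 3" "\<bar>23/3 * r\<^sup>2 - 2\<bar> * t\<^sup>2 \<le> 17/3 * t\<^sup>2" "49/3 * r\<^sup>2 * t \<le> 49/3 * t"
        using r2 t by (intro mult_right_mono; simp add: abs_if)+
      then show ?thesis using cH unfolding h_def by linarith
    qed
    have h23: "h \<le> 23"
      using power_le_one[OF t, of 2] power_le_one[OF t, of 3] t unfolding h_def by linarith
    have D0: "0 \<le> D" using t by (simp add: D_def)
    have "2 * K * (- Re H - B) + d * ((cmod H)\<^sup>2 - B\<^sup>2) \<le> 0"
      if HB: "\<not> cmod H \<le> B"
    proof -
      \<comment> \<open>here K is bounded below and d above by 1/5, so the quadratic term d ((cmod H)^2 - B^2) is small\<close>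
      have "(4/5)\<^sup>2 \<le> (r\<^sup>2)\<^sup>2" using r2 by (intro power_mono) auto
      moreover have "(r\<^sup>2)\<^sup>2 = r ^ 4" by simp
      moreover have "(4/5 :: real)\<^sup>2 = 16/25" by (simp add: power2_eq_square)
      ultimately have K: "64/5 \<le> 2 * K" unfolding K_def by linarith
      have "2 * K * (- Re H - B) \<le> 2 * K * (D - B)"
        using ReH K0 by (intro mult_left_mono) auto
      also have "\<dots> \<le> 64/5 * (D - B)"
        using K DB by (intro mult_right_mono_neg) auto
      finally have 1: "2 * K * (- Re H - B) \<le> 64/5 * (D - B)" .
      have "d * ((cmod H)\<^sup>2 - B\<^sup>2) = d * ((cmod H + B) * (cmod H - B))"
        by (simp add: power2_eq_square algebra_simps)
      also have "\<dots> \<le> 1/5 * (46 * (h - B))"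
        using HB Hh h23 D0 DB d r2 by (intro mult_mono mult_nonneg_nonneg) (auto simp: d_def)
      finally have 2: "d * ((cmod H)\<^sup>2 - B\<^sup>2) \<le> 1/5 * (46 * (h - B))" .
      have "2 * K * (- Re H - B) + d * ((cmod H)\<^sup>2 - B\<^sup>2)
          \<le> 64/5 * (D - B) + 1/5 * (46 * (h - B))"
        by (rule add_mono[OF 1 2])
      also have "\<dots> = (64/5 * D + 46/5 * h) - 22 * B"
        by (simp add: field_simps)
      also have "\<dots> \<le> 0" using DhB by simp
      finally show ?thesis .
    qed
    then show ?thesis using D0 DB by auto
  qed
  have main: "cmod (d * H - K) \<le> K + d * B"
    using alt d K0 by (intro norm_scaled_minus_real_le) auto
  have rest: "cmod (s - (2 * r * x + 17/3 * r) * y) \<le> (1 - t\<^sup>2) * M"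
  proof -
    have "cmod (2 * r * x + 17/3 * r) \<le> 2 * r * t + 17/3 * r"
      using norm_triangle_ineq[of "2 * r * x" "17/3 * r"] r by (simp add: norm_mult t_def)
    then have "cmod ((2 * r * x + 17/3 * r) * y) \<le> (2 * r * t + 17/3 * r) * (1 - t\<^sup>2)"
      unfolding norm_mult using y t r by (intro mult_mono) (auto simp: t_def)
    then show ?thesis
      using norm_triangle_ineq4[of s "(2 * r * x + 17/3 * r) * y"] s
      by (simp add: M_def t_def algebra_simps)
  qed
  have A_eq: "?A = - (d * (s - (2 * r * x + 17/3 * r) * y) + (d * H - K)) / 4"
    by (simp add: d_def H_def K_def power2_eq_square power3_eq_cube power4_eq_xxxx field_simps)
  have "cmod ?A = cmod (d * (s - (2 * r * x + 17/3 * r) * y) + (d * H - K)) / 4"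
    unfolding A_eq by (simp only: norm_divide norm_minus_cancel norm_numeral)
  also have "\<dots> \<le> (d * ((1 - t\<^sup>2) * M) + (K + d * B)) / 4"
  proof (intro divide_right_mono norm_triangle_mono main)
    show "cmod (d * (s - (2 * r * x + 17/3 * r) * y)) \<le> d * ((1 - t\<^sup>2) * M)"
      unfolding norm_mult using rest d by (intro mult_mono) auto
  qed simp
  also have "\<dots> = 361/144"
    by (simp add: d_def K_def B_def power2_eq_square power4_eq_xxxx field_simps)
  finally show ?thesis .
qed

lemma inverse_coeff_bounds:
  assumes f: "f \<in> class_S_e" and A: "inverse_expansion f A"
  shows "cmod (fps_nth A 2) \<le> 1" and "cmod (fps_nth A 3) \<le> 5 / 4"
    and "cmod (fps_nth A 4) \<le> 31 / 18" and "cmod (fps_nth A 5) \<le> 361 / 144"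
proof -
  have f': "f holomorphic_on unit_disc" "f 0 = 0" "deriv f 0 = 1"
    using f by (auto simp: class_S_e_def class_A_def analytic_on_open)
  obtain w where w: "w holomorphic_on unit_disc" "w ` unit_disc \<subseteq> unit_disc" "w 0 = 0"
    and quot: "\<forall>z\<in>unit_disc. starlike_quotient f z = exp (w z)"
    using f by (auto simp: class_S_e_def subordinate_def analytic_on_open)
  have bd: "cmod (w z) < 1" if "cmod z < 1" for z
    using w(2) that by (auto simp: image_subset_iff)
  define W where "W = fps_expansion w 0"
  have W: "w has_fps_expansion W"
    unfolding W_def using w(1) by (intro has_fps_expansion_fps_expansion) auto
  note formulas = class_S_e_coeff_formulas[OF f' w(3) W quot A]
  obtain u x y s :: complex and r :: real
    where u: "cmod u = 1" and r: "0 \<le> r" "r \<le> 1"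
    and x: "cmod x \<le> 1" and y: "cmod y \<le> 1 - (cmod x)\<^sup>2" and s: "cmod s \<le> 1 - (cmod x)\<^sup>2"
    and c: "fps_nth W 1 = u * r"
    "fps_nth W 2 = u ^ 2 * ((1 - r\<^sup>2) * x)"
    "fps_nth W 3 = u ^ 3 * ((1 - r\<^sup>2) * (y - r * x\<^sup>2))"
    "fps_nth W 4 = u ^ 4 * ((1 - r\<^sup>2) * (s - 2 * r * x * y + r\<^sup>2 * x ^ 3))"
    by (rule Schwarz_coeffs[OF w(1,3) bd W])
  have rotate: "cmod (u ^ n * p) = cmod p" for n p
    by (simp add: norm_mult norm_power u)
  show "cmod (fps_nth A 2) \<le> 1"
    unfolding formulas c using r u by (simp add: norm_mult)
  have "fps_nth A 3 = u ^ 2 * (- ((1 - r\<^sup>2) * x) / 2 + 5/4 * r ^ 2)"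
    unfolding formulas c by (simp add: field_simps)
  then show "cmod (fps_nth A 3) \<le> 5 / 4"
    using third_coeff_bound[OF r x] rotate by metis
  have "fps_nth A 4 = u ^ 3 * (- ((1 - r\<^sup>2) * (y - r * x\<^sup>2)) / 3
      + 5/3 * r * ((1 - r\<^sup>2) * x) - 31/18 * r ^ 3)"
    unfolding formulas c by (simp add: field_simps power2_eq_square power3_eq_cube)
  then show "cmod (fps_nth A 4) \<le> 31 / 18"
    using fourth_coeff_bound[OF r x y] rotate by metis
  have "fps_nth A 5 = u ^ 4 * (- ((1 - r\<^sup>2) * (s - 2 * r * x * y + r\<^sup>2 * x ^ 3)) / 4
           + 17/12 * r * ((1 - r\<^sup>2) * (y - r * x\<^sup>2)) + ((1 - r\<^sup>2) * x)\<^sup>2 / 2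
           - 49/12 * r\<^sup>2 * ((1 - r\<^sup>2) * x) + 361/144 * r ^ 4)"
    unfolding formulas c
    by (simp add: field_simps power2_eq_square power3_eq_cube power4_eq_xxxx)
  then show "cmod (fps_nth A 5) \<le> 361 / 144"
    using fifth_coeff_bound[OF r x y s] rotate by metis
qed

section \<open>The extremal function\<close>

lemma inverse_expansion_exists:
  assumes f: "f holomorphic_on unit_disc" "f 0 = 0" "deriv f 0 \<noteq> 0"
  obtains A where "inverse_expansion f A"
proof -
  obtain r where r: "r > 0" "ball 0 r \<subseteq> unit_disc" "open (f ` ball 0 r)" "inj_on f (ball 0 r)"
    by (rule has_complex_derivative_locally_invertible[OF f(1) _ _ f(3)]) auto
  have hol: "f holomorphic_on ball 0 r" using f(1) r(2) holomorphic_on_subset by blast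
  obtain g where g: "g holomorphic_on f ` ball 0 r" "\<And>z. z \<in> ball 0 r \<Longrightarrow> g (f z) = z"
    using holomorphic_has_inverse[OF hol open_ball r(4)] by metis
  have z: "0 \<in> f ` ball 0 r" using r(1) f(2) by (intro image_eqI[of _ _ 0]) auto
  have gi: "g ` f ` ball 0 r = ball 0 r" using g(2) by force
  have "homeomorphism (ball 0 r) (f ` ball 0 r) f g"
    unfolding homeomorphism_def
    using g(2) gi hol g(1) by (auto intro: holomorphic_on_imp_continuous_on)
  moreover have "g 0 = 0" using g(2)[of 0] r(1) f(2) by simp
  ultimately have "local_inverse_at_0 f g"
    unfolding local_inverse_at_0_def using r z by (metis centre_in_ball open_ball)
  moreover have "g has_fps_expansion fps_expansion g 0"
    using g(1) r(3) z by (intro has_fps_expansion_fps_expansion)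
  ultimately show thesis using that unfolding inverse_expansion_def by blast
qed

text \<open>
  This is the member of the class with \<open>w z = z\<close>, whose inverse attains all four bounds.
\<close>

lemma extremal_function:
  obtains f where "f holomorphic_on UNIV" "f 0 = 0" "deriv f 0 = 1"
    "\<And>z. starlike_quotient f z = exp z"
proof -
  \<comment> \<open>f = z exp h, where h is the primitive of (exp z - 1) / z with h 0 = 0\<close>
  define k where "k = (\<lambda>z::complex. if z = 0 then 1 else (exp z - 1) / z)"
  have "k holomorphic_on UNIV"
  proof (rule pole_theorem_open_0[of "\<lambda>z. exp z - 1" UNIV 0 k])
    have "deriv (\<lambda>z::complex. exp z - 1) 0 = 1"
      by (intro DERIV_imp_deriv) (auto intro!: derivative_eq_intros)
    then show "k 0 = deriv (\<lambda>z. exp z - 1) 0" by (simp add: k_def)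
  qed (auto simp: k_def intro!: holomorphic_intros)
  then obtain h0 where h0: "\<And>z. (h0 has_field_derivative k z) (at z)"
    using holomorphic_convex_primitive'[of UNIV k] by auto
  define h where "h = (\<lambda>z. h0 z - h0 0)"
  have h: "(h has_field_derivative k z) (at z)" for z
    unfolding h_def by (auto intro!: derivative_eq_intros h0)
  define f where "f = (\<lambda>z. z * exp (h z))"
  have f': "(f has_field_derivative exp z * exp (h z)) (at z)" for z
  proof -
    have "(f has_field_derivative exp (h z) + z * (exp (h z) * k z)) (at z)"
      unfolding f_def by (auto intro!: derivative_eq_intros h)
    moreover have "z * k z = exp z - 1" by (simp add: k_def)
    then have "exp (h z) + z * (exp (h z) * k z) = exp z * exp (h z)" by algebra
    ultimately show ?thesis by simp
  qed
  have "f holomorphic_on UNIV"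
    using f' by (meson field_differentiable_at_within field_differentiable_def holomorphic_on_def)
  moreover have "f 0 = 0" by (simp add: f_def)
  moreover have "deriv f 0 = 1" using DERIV_imp_deriv[OF f'[of 0]] by (simp add: h_def)
  moreover have "starlike_quotient f z = exp z" for z
    using DERIV_imp_deriv[OF f'[of z]] by (simp add: starlike_quotient_def f_def)
  ultimately show thesis by (rule that)
qed

text \<open>
  With \<open>w z = z\<close> only the pure powers of the first coefficient survive in the formulas, and their
  factors are the claimed bounds up to sign.
\<close>

lemma extremal_inverse_coeffs:
  obtains f A where "f \<in> class_S_e" "inverse_expansion f A"
    "cmod (fps_nth A 2) = 1" "cmod (fps_nth A 3) = 5 / 4"
    "cmod (fps_nth A 4) = 31 / 18" "cmod (fps_nth A 5) = 361 / 144"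
proof -
  obtain f where f: "f holomorphic_on UNIV" "f 0 = 0" "deriv f 0 = 1"
    and quot: "\<forall>z\<in>unit_disc. starlike_quotient f z = exp z"
    and quot_eq: "starlike_quotient f = exp"
    using extremal_function by (metis ext)
  have hol: "f holomorphic_on unit_disc" using f(1) holomorphic_on_subset by blast
  have "exp analytic_on unit_disc"
    by (simp add: analytic_on_open holomorphic_on_exp)
  moreover have "(\<lambda>z. z) analytic_on unit_disc" "(\<lambda>z. z) ` unit_disc \<subseteq> unit_disc"
    by (auto intro: analytic_on_ident)
  ultimately have "starlike_quotient f \<prec> exp"
    unfolding subordinate_def quot_eq by (intro conjI exI[of _ "\<lambda>z. z"]) auto
  then have "f \<in> class_S_e"
    using hol f by (simp add: class_S_e_def class_A_def analytic_on_open)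
  moreover obtain A where A: "inverse_expansion f A"
    using inverse_expansion_exists[OF hol f(2)] f(3) by auto
  moreover note formulas =
    class_S_e_coeff_formulas[OF hol f(2,3) refl has_fps_expansion_fps_X quot A]
  have "cmod (fps_nth A 2) = 1" "cmod (fps_nth A 3) = 5 / 4"
    "cmod (fps_nth A 4) = 31 / 18" "cmod (fps_nth A 5) = 361 / 144"
    unfolding formulas by simp_all
  ultimately show thesis by (rule that)
qed

section \<open>The sharp bounds\<close>

theorem theorem2p4:
  shows "(\<forall>f\<in>class_S_e. \<forall>A. inverse_expansion f A \<longrightarrow>
            cmod (fps_nth A 2) \<le> 1 \<and> cmod (fps_nth A 3) \<le> 5 / 4 \<and>
            cmod (fps_nth A 4) \<le> 31 / 18 \<and> cmod (fps_nth A 5) \<le> 361 / 144)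
       \<and> (\<exists>f\<in>class_S_e. \<exists>A. inverse_expansion f A \<and> cmod (fps_nth A 2) = 1)
       \<and> (\<exists>f\<in>class_S_e. \<exists>A. inverse_expansion f A \<and> cmod (fps_nth A 3) = 5 / 4)
       \<and> (\<exists>f\<in>class_S_e. \<exists>A. inverse_expansion f A \<and> cmod (fps_nth A 4) = 31 / 18)
       \<and> (\<exists>f\<in>class_S_e. \<exists>A. inverse_expansion f A \<and> cmod (fps_nth A 5) = 361 / 144)"
proof (intro conjI ballI allI impI)
  fix f A assume "f \<in> class_S_e" "inverse_expansion f A"
  then show "cmod (fps_nth A 2) \<le> 1" "cmod (fps_nth A 3) \<le> 5 / 4"
    "cmod (fps_nth A 4) \<le> 31 / 18" "cmod (fps_nth A 5) \<le> 361 / 144"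
    by (rule inverse_coeff_bounds)+
qed (use extremal_inverse_coeffs in metis)+

end
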